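(* Let $\varepsilon \leq 1/2$. Let $G$ be a (finite, simple) graph with demand function $f$ such that $f(v) \leq 1/(d(v) + 1 - \varepsilon)$ for each $v\in V(G)$ and $\sum_{v\in K}f(v) \leq 1$ for each clique $K\subseteq V(G)$. Then $G$ has an $f$-coloring.
   Context: A demand function for a graph $G$ is a function $f: V(G)\to [0,1]\cap\mathbb{Q}$. A fractional coloring of $G$ is a function $\phi$ assigning to each $v\in V(G)$ a measurable subset $\phi(v)\subseteq[0,1]$ such that $\phi(u)\cap\phi(v)=\varnothing$ for every edge $uv$. An $f$-coloring is a fractional coloring $\phi$ with $\mu(\phi(v))\geq f(v)$ for every $v$, where $\mu$ is Lebesgue measure. $d(v)$ denotes the degree of $v$. *)

theory Defs
  imports "HOL-Analysis.Analysis"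
begin

definition simple_graph :: "'a set \<Rightarrow> ('a \<Rightarrow> 'a \<Rightarrow> bool) \<Rightarrow> bool" where
  "simple_graph V E \<longleftrightarrow> finite V \<and> (\<forall>u v. E u v \<longrightarrow> u \<in> V \<and> v \<in> V)
     \<and> (\<forall>u v. E u v \<longrightarrow> E v u) \<and> (\<forall>v. \<not> E v v)"

definition degree :: "'a set \<Rightarrow> ('a \<Rightarrow> 'a \<Rightarrow> bool) \<Rightarrow> 'a \<Rightarrow> nat" where
  "degree V E v = card {u \<in> V. E v u}"

definition clique :: "'a set \<Rightarrow> ('a \<Rightarrow> 'a \<Rightarrow> bool) \<Rightarrow> 'a set \<Rightarrow> bool" where
  "clique V E K \<longleftrightarrow> K \<subseteq> V \<and> (\<forall>u\<in>K. \<forall>v\<in>K. u \<noteq> v \<longrightarrow> E u v)"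

definition demand_function :: "'a set \<Rightarrow> ('a \<Rightarrow> real) \<Rightarrow> bool" where
  "demand_function V f \<longleftrightarrow> (\<forall>v\<in>V. f v \<in> \<rat> \<and> 0 \<le> f v \<and> f v \<le> 1)"

definition fractional_coloring :: "'a set \<Rightarrow> ('a \<Rightarrow> 'a \<Rightarrow> bool) \<Rightarrow> ('a \<Rightarrow> real set) \<Rightarrow> bool" where
  "fractional_coloring V E \<phi> \<longleftrightarrow>
     (\<forall>v\<in>V. \<phi> v \<in> sets lebesgue \<and> \<phi> v \<subseteq> {0..1})
     \<and> (\<forall>u\<in>V. \<forall>v\<in>V. E u v \<longrightarrow> \<phi> u \<inter> \<phi> v = {})"

definition f_coloring :: "'a set \<Rightarrow> ('a \<Rightarrow> 'a \<Rightarrow> bool) \<Rightarrow> ('a \<Rightarrow> real) \<Rightarrow> ('a \<Rightarrow> real set) \<Rightarrow> bool" where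
  "f_coloring V E f \<phi> \<longleftrightarrow> fractional_coloring V E \<phi>
     \<and> (\<forall>v\<in>V. measure lebesgue (\<phi> v) \<ge> f v)"

end

theory Submission
  imports Defs
begin

text \<open>
  A fractional coloring is a probability distribution on the stable sets of the graph, with the
  demands as marginals. One may take \<open>\<epsilon> = 1/2\<close> and argue by induction on the number of vertices.

  If the demands in some closed neighbourhood \<open>N[x]\<close> sum to at most 1, then \<open>x\<close> can be added greedily
  to a coloring of the rest. Otherwise no \<open>N[x]\<close> is a clique. Then a clique of size \<open>k\<close> has only
  vertices of degree at least \<open>k\<close>, and the demands can be raised to \<open>F v = 1 / (d v + 1/2)\<close>.

  For each \<open>v\<close>, color \<open>V - {v}\<close> by induction, with the demand of each neighbour \<open>u\<close> of \<open>v\<close> raised from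
  \<open>1 / (d u + 1/2)\<close> towards \<open>1 / (d u - 1/2)\<close>, and take the average of these colorings over all \<open>v\<close>.
  Each vertex is lost once and gains once per neighbour, and this balances with half a gain to spare.
  A clique \<open>K\<close> limits the gain only through vertices \<open>u\<close> with \<open>N[u] = K \<union> {v}\<close>, and there the spare
  half gain pays for the limitation, unless \<open>N[u]\<close> is a clique minus a single edge \<open>v\<^sub>1v\<^sub>2\<close>
  and \<open>u\<close> has many twins. In that case remove the class of \<open>u\<close> and mix a coloring of the rest in
  which \<open>v\<^sub>1\<close> and \<open>v\<^sub>2\<close> are identified with one in which they are not: this makes their color sets
  overlap just enough to fit the twins in again.
\<close>

section \<open>Distributions on stable sets\<close>

definition stable_dist :: "'a set \<Rightarrow> ('a \<Rightarrow> 'a \<Rightarrow> bool) \<Rightarrow> ('a set \<Rightarrow> real) \<Rightarrow> bool" where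
  "stable_dist V E p \<longleftrightarrow> (\<forall>I. 0 \<le> p I) \<and>
     (\<forall>I\<in>Pow V. p I \<noteq> 0 \<longrightarrow> (\<forall>u\<in>I. \<forall>v\<in>I. \<not> E u v)) \<and> sum p (Pow V) = 1"

text \<open>The probability that the random stable set contains all of \<open>W\<close>. Singletons
  give the marginals; pairs measure the overlap of two color sets, which the identification step has
  to control.\<close>

definition cover :: "'a set \<Rightarrow> ('a set \<Rightarrow> real) \<Rightarrow> 'a set \<Rightarrow> real" where
  "cover V p W = (\<Sum>I\<in>Pow V. p I * of_bool (W \<subseteq> I))"

text \<open>Demands are met exactly, so that marginals can be computed with when colorings are mixed
  or extended. For nonnegative demands \<open>colorable_trim\<close> turns a surplus into
  equality.\<close>

definition colorable :: "'a set \<Rightarrow> ('a \<Rightarrow> 'a \<Rightarrow> bool) \<Rightarrow> ('a \<Rightarrow> real) \<Rightarrow> bool" where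
  "colorable V E f \<longleftrightarrow> (\<exists>p. stable_dist V E p \<and> (\<forall>v\<in>V. cover V p {v} = f v))"

lemma sum_Pow_insert:
  fixes g :: "'a set \<Rightarrow> real"
  assumes "finite V" "x \<notin> V"
  shows "sum g (Pow (insert x V)) = (\<Sum>I\<in>Pow V. g I + g (insert x I))"
proof -
  have "inj_on (insert x) (Pow V)"
    using assms(2) by (auto simp: inj_on_def)
  moreover have "Pow V \<inter> insert x ` Pow V = {}"
    using assms(2) by auto
  ultimately show ?thesis
    using assms(1) by (simp add: Pow_insert sum.union_disjoint sum.reindex sum.distrib)
qed

lemma cover_nonneg: "stable_dist V E p \<Longrightarrow> 0 \<le> cover V p W"
  unfolding cover_def stable_dist_def by (auto intro!: sum_nonneg)

text \<open>The greedy step: the random set misses the neighbourhood of \<open>x\<close> with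
  probability at least \<open>y\<close>, and on that event \<open>x\<close> can be thrown in at
  random.\<close>

lemma stable_dist_extend:
  fixes p :: "'a set \<Rightarrow> real"
  assumes V: "finite V" "x \<notin> V" and E: "\<And>u v. E u v \<Longrightarrow> E v u" "\<not> E x x"
    and p: "stable_dist V E p" and y: "0 \<le> y"
    and room: "y + (\<Sum>I\<in>Pow V. p I * of_bool (\<exists>u\<in>I. E x u)) \<le> 1"
  obtains p' where "stable_dist (insert x V) E p'" "cover (insert x V) p' {x} = y"
    "\<And>W. W \<subseteq> V \<Longrightarrow> cover (insert x V) p' W = cover V p W"
proof -
  define R where "R = (\<Sum>I\<in>Pow V. p I * of_bool (\<not> (\<exists>u\<in>I. E x u)))"
  have "R + (\<Sum>I\<in>Pow V. p I * of_bool (\<exists>u\<in>I. E x u)) = sum p (Pow V)"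
    unfolding R_def sum.distrib[symmetric] by (intro sum.cong) auto
  then have R: "y \<le> R"
    using room p unfolding stable_dist_def by linarith
  \<comment> \<open>The conditional probability that \<open>x\<close> joins \<open>I\<close>. If
    \<open>R = 0\<close>, then \<open>y = 0\<close>, and \<open>y / R = 0\<close> is still the right
    value.\<close>
  define \<theta> where "\<theta> I = of_bool (\<not> (\<exists>u\<in>I. E x u)) * (y / R)" for I
  have \<theta>: "0 \<le> \<theta> I" "\<theta> I \<le> 1" for I
    using R y unfolding \<theta>_def by (auto simp: divide_le_eq_1)
  define p' where
    "p' I = (if x \<in> I then \<theta> (I - {x}) * p (I - {x}) else (1 - \<theta> I) * p I)" for I
  have pnn: "0 \<le> p I" for I using p unfolding stable_dist_def by auto
  have out: "p' I = (1 - \<theta> I) * p I" and inn: "p' (insert x I) = \<theta> I * p I" if "I \<in> Pow V" for I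
  proof -
    have "x \<notin> I" "I - {x} = I" using that V(2) by auto
    then show "p' I = (1 - \<theta> I) * p I" "p' (insert x I) = \<theta> I * p I" by (simp_all add: p'_def)
  qed
  have st: "stable_dist (insert x V) E p'"
    unfolding stable_dist_def
  proof (intro conjI allI ballI impI)
    show "0 \<le> p' I" for I
      using \<theta> pnn by (auto simp: p'_def)
    show "sum p' (Pow (insert x V)) = 1"
    proof -
      have "sum p' (Pow (insert x V)) = sum p (Pow V)"
        unfolding sum_Pow_insert[OF V] by (intro sum.cong) (auto simp: out inn algebra_simps)
      then show ?thesis using p unfolding stable_dist_def by simp
    qed
    fix I u v assume I: "I \<in> Pow (insert x V)" "p' I \<noteq> 0" "u \<in> I" "v \<in> I"
    have pst: "\<not> E a b" if "J \<in> Pow V" "p J \<noteq> 0" "a \<in> J" "b \<in> J" for J a b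
      using p that unfolding stable_dist_def by blast
    show "\<not> E u v"
    proof (cases "x \<in> I")
      case True
      then have "p (I - {x}) \<noteq> 0" "\<theta> (I - {x}) \<noteq> 0" using I(2) by (auto simp: p'_def)
      moreover from this have "\<forall>u\<in>I - {x}. \<not> E x u" by (auto simp: \<theta>_def)
      ultimately show ?thesis using I E pst[of "I - {x}" u v] by blast
    next
      case False
      then show ?thesis using I pst[of I u v] by (auto simp: p'_def)
    qed
  qed
  have cx: "cover (insert x V) p' {x} = y"
  proof -
    have "cover (insert x V) p' {x} = (\<Sum>I\<in>Pow V. \<theta> I * p I)"
      unfolding cover_def sum_Pow_insert[OF V]
      using V(2) by (intro sum.cong) (auto simp: inn)
    also have "\<dots> = (y / R) * R"
      unfolding R_def sum_distrib_left by (intro sum.cong) (auto simp: \<theta>_def R_def)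
    also have "\<dots> = y" using R y by auto
    finally show ?thesis .
  qed
  have cW: "cover (insert x V) p' W = cover V p W" if "W \<subseteq> V" for W
  proof -
    have "W \<subseteq> insert x I \<longleftrightarrow> W \<subseteq> I" for I using that V(2) by auto
    then show ?thesis
      unfolding cover_def sum_Pow_insert[OF V]
      by (intro sum.cong) (auto simp: out inn algebra_simps)
  qed
  show thesis using that st cx cW by blast
qed

text \<open>Dropping \<open>x\<close> from the random set with a fixed probability keeps it stable
  and leaves the other marginals alone.\<close>

lemma stable_dist_trim_vertex:
  fixes p :: "'a set \<Rightarrow> real"
  assumes V: "finite V" "x \<in> V" and p: "stable_dist V E p" and y: "0 \<le> y" "y \<le> cover V p {x}"
  obtains p' where "stable_dist V E p'" "cover V p' {x} = y"
    "\<And>v. v \<noteq> x \<Longrightarrow> cover V p' {v} = cover V p {v}"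
proof -
  define U where "U = V - {x}"
  have U: "finite U" "x \<notin> U" and VU: "V = insert x U" using V by (auto simp: U_def)
  define \<theta> where "\<theta> = y / cover V p {x}"
  have \<theta>: "0 \<le> \<theta>" "\<theta> \<le> 1" using y by (auto simp: \<theta>_def divide_le_eq_1)
  define p' where "p' I = (if x \<in> I then \<theta> * p I else p I + (1 - \<theta>) * p (insert x I))" for I
  have pnn: "0 \<le> p I" for I using p unfolding stable_dist_def by auto
  have out: "p' I = p I + (1 - \<theta>) * p (insert x I)" and inn: "p' (insert x I) = \<theta> * p (insert x I)"
    if "I \<in> Pow U" for I using that U(2) by (auto simp: p'_def)
  have st: "stable_dist V E p'"
    unfolding stable_dist_def
  proof (intro conjI allI ballI impI)
    show "0 \<le> p' I" for I
      using \<theta> pnn by (auto simp: p'_def)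
    have "sum p' (Pow V) = sum p (Pow V)"
      unfolding VU sum_Pow_insert[OF U] by (intro sum.cong) (auto simp: out inn algebra_simps)
    then show "sum p' (Pow V) = 1" using p unfolding stable_dist_def by simp
    fix I u v assume I: "I \<in> Pow V" "p' I \<noteq> 0" "u \<in> I" "v \<in> I"
    have pst: "\<not> E a b" if "J \<in> Pow V" "p J \<noteq> 0" "a \<in> J" "b \<in> J" for J a b
      using p that unfolding stable_dist_def by blast
    have "p I \<noteq> 0 \<or> p (insert x I) \<noteq> 0" using I(2) by (auto simp: p'_def split: if_splits)
    then show "\<not> E u v" using pst[of I u v] pst[of "insert x I" u v] I V(2) by auto
  qed
  have "cover V p' {x} = \<theta> * cover V p {x}"
    unfolding cover_def VU sum_Pow_insert[OF U] sum_distrib_left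
    using U(2) by (intro sum.cong) (auto simp: inn)
  then have cx: "cover V p' {x} = y" using y by (auto simp: \<theta>_def)
  have cv: "cover V p' {v} = cover V p {v}" if "v \<noteq> x" for v
    unfolding cover_def VU sum_Pow_insert[OF U]
    using that by (intro sum.cong) (auto simp: inn out algebra_simps)
  show thesis using that st cx cv by blast
qed

lemma colorable_trim:
  assumes V: "finite V" and p: "stable_dist V E p" and f: "\<And>v. v \<in> V \<Longrightarrow> 0 \<le> f v \<and> f v \<le> cover V p {v}"
  shows "colorable V E f"
proof -
  have "\<exists>p'. stable_dist V E p' \<and> (\<forall>v\<in>S. cover V p' {v} = f v) \<and>
     (\<forall>v\<in>V - S. cover V p' {v} = cover V p {v})" if "finite S" "S \<subseteq> V" for S
    using that
  proof (induction S rule: finite_induct)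
    case empty
    then show ?case using p by auto
  next
    case (insert x S)
    then obtain p' where p': "stable_dist V E p'" "\<forall>v\<in>S. cover V p' {v} = f v"
      "\<forall>v\<in>V - S. cover V p' {v} = cover V p {v}" by auto
    have "0 \<le> f x" "f x \<le> cover V p' {x}" "x \<in> V" using insert f p'(3) by auto
    then obtain p'' where "stable_dist V E p''" "cover V p'' {x} = f x"
      and other: "\<And>v. v \<noteq> x \<Longrightarrow> cover V p'' {v} = cover V p' {v}"
      using stable_dist_trim_vertex[OF V _ p'(1)] by metis
    moreover have "cover V p'' {v} = f v" if "v \<in> S" for v
      using that p'(2) other[of v] insert.hyps(2) by auto
    ultimately show ?case using p'(3) other by (intro exI[of _ p'']) auto
  qed
  from this[of V] V show ?thesis unfolding colorable_def by auto
qed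

lemma stable_dist_average:
  assumes "finite J" "\<And>j. j \<in> J \<Longrightarrow> stable_dist V E (P j)" "\<And>j. j \<in> J \<Longrightarrow> (0::real) \<le> \<alpha> j" "sum \<alpha> J = 1"
  shows "stable_dist V E (\<lambda>I. \<Sum>j\<in>J. \<alpha> j * P j I)"
  unfolding stable_dist_def
proof (intro conjI allI ballI impI)
  show "0 \<le> (\<Sum>j\<in>J. \<alpha> j * P j I)" for I
    using assms unfolding stable_dist_def by (auto intro!: sum_nonneg)
  have "(\<Sum>I\<in>Pow V. \<Sum>j\<in>J. \<alpha> j * P j I) = (\<Sum>j\<in>J. \<alpha> j * sum (P j) (Pow V))"
    by (subst sum.swap) (simp add: sum_distrib_left)
  also have "\<dots> = 1" using assms unfolding stable_dist_def by simp
  finally show "(\<Sum>I\<in>Pow V. \<Sum>j\<in>J. \<alpha> j * P j I) = 1" .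
  fix I u v assume I: "I \<in> Pow V" "(\<Sum>j\<in>J. \<alpha> j * P j I) \<noteq> 0" "u \<in> I" "v \<in> I"
  then obtain j where "j \<in> J" "\<alpha> j * P j I \<noteq> 0" by (meson sum.neutral)
  then show "\<not> E u v" using assms(2)[of j] I unfolding stable_dist_def by auto
qed

lemma cover_average:
  "cover V (\<lambda>I. \<Sum>j\<in>J. \<alpha> j * P j I) W = (\<Sum>j\<in>J. \<alpha> j * cover V (P j) W)"
  unfolding cover_def sum_distrib_right sum_distrib_left
  by (subst sum.swap) (simp add: mult.assoc)

text \<open>Extension by zero: the vertices outside \<open>V'\<close> are never chosen.\<close>

lemma stable_dist_lift:
  assumes V: "finite V" "V' \<subseteq> V" and p: "stable_dist V' E p"
  obtains p' where "stable_dist V E p'"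
    "\<And>W. cover V p' W = (if W \<subseteq> V' then cover V' p W else 0)"
proof -
  define p' where "p' I = (if I \<subseteq> V' then p I else 0)" for I
  have s: "(\<Sum>I\<in>Pow V. p' I * g I) = (\<Sum>I\<in>Pow V'. p I * g I)" for g
    using V by (intro sum.mono_neutral_cong_right) (auto simp: p'_def)
  have "stable_dist V E p'"
    using p s[of "\<lambda>_. 1"] V(2) unfolding stable_dist_def by (auto simp: p'_def)
  moreover have "cover V p' W = (if W \<subseteq> V' then cover V' p W else 0)" for W
  proof (cases "W \<subseteq> V'")
    case True
    then show ?thesis unfolding cover_def s by simp
  next
    case False
    then have "\<not> W \<subseteq> I" if "I \<in> Pow V'" for I using that by blast
    then show ?thesis using False unfolding cover_def s by simp
  qed
  ultimately show thesis using that by blast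
qed

lemma union_bound:
  assumes V: "finite V" and p: "stable_dist V E p"
  shows "(\<Sum>I\<in>Pow V. p I * of_bool (\<exists>u\<in>I. E x u)) \<le> (\<Sum>u\<in>{u \<in> V. E x u}. cover V p {u})"
proof -
  have "(\<Sum>I\<in>Pow V. p I * of_bool (\<exists>u\<in>I. E x u)) \<le>
      (\<Sum>I\<in>Pow V. p I * (\<Sum>u\<in>{u \<in> V. E x u}. of_bool ({u} \<subseteq> I)))"
  proof (intro sum_mono mult_left_mono)
    fix I assume I: "I \<in> Pow V"
    show "0 \<le> p I" using p unfolding stable_dist_def by simp
    show "of_bool (\<exists>u\<in>I. E x u) \<le> (\<Sum>u\<in>{u \<in> V. E x u}. of_bool ({u} \<subseteq> I) :: real)"
    proof (cases "\<exists>u\<in>I. E x u")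
      case True
      then obtain u where u: "u \<in> I" "E x u" by blast
      then have "of_bool ({u} \<subseteq> I) \<le> (\<Sum>u\<in>{u \<in> V. E x u}. of_bool ({u} \<subseteq> I) :: real)"
        using V I by (intro member_le_sum) auto
      then show ?thesis using u True by simp
    qed (simp add: sum_nonneg)
  qed
  also have "\<dots> = (\<Sum>u\<in>{u \<in> V. E x u}. cover V p {u})"
    unfolding cover_def sum_distrib_left by (rule sum.swap)
  finally show ?thesis .
qed

text \<open>Undoes an identification: \<open>v\<close> stands for the merged vertex of
  \<open>E'\<close>, and the copy \<open>w\<close> is put into exactly the sets that contain
  \<open>v\<close>. The two copies then overlap completely.\<close>

lemma stable_dist_duplicate:
  assumes V: "finite V" "w \<notin> V" "v \<in> V" and p: "stable_dist V E' p"
    and E': "\<And>a b. a \<in> V \<Longrightarrow> b \<in> V \<Longrightarrow> E a b \<Longrightarrow> E' a b"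
      "\<And>a. a \<in> V \<Longrightarrow> E a w \<or> E w a \<Longrightarrow> E' v a"
    and nadj: "\<not> E w w"
  obtains p' where "stable_dist (insert w V) E p'"
    "\<And>W. W \<subseteq> V \<Longrightarrow> cover (insert w V) p' W = cover V p W"
    "cover (insert w V) p' {w} = cover V p {v}"
    "cover (insert w V) p' {v, w} = cover V p {v}"
proof -
  define p' where "p' I = (if v \<in> I \<longleftrightarrow> w \<in> I then p (I - {w}) else 0)" for I
  have out: "p' I = p I * of_bool (v \<notin> I)" and inn: "p' (insert w I) = p I * of_bool (v \<in> I)"
    if "I \<in> Pow V" for I
  proof -
    have "w \<notin> I" "I - {w} = I" "v \<noteq> w" using that V by auto
    then show "p' I = p I * of_bool (v \<notin> I)" "p' (insert w I) = p I * of_bool (v \<in> I)"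
      by (simp_all add: p'_def)
  qed
  have pnn: "0 \<le> p I" for I using p unfolding stable_dist_def by auto
  have pst: "\<not> E' a b" if "J \<in> Pow V" "p J \<noteq> 0" "a \<in> J" "b \<in> J" for J a b
    using p that unfolding stable_dist_def by blast
  have st: "stable_dist (insert w V) E p'"
    unfolding stable_dist_def
  proof (intro conjI allI ballI impI)
    show "0 \<le> p' I" for I using pnn by (simp add: p'_def)
    have "sum p' (Pow (insert w V)) = sum p (Pow V)"
      unfolding sum_Pow_insert[OF V(1,2)] by (intro sum.cong) (auto simp: out inn)
    then show "sum p' (Pow (insert w V)) = 1" using p unfolding stable_dist_def by simp
    fix I a b assume I: "I \<in> Pow (insert w V)" "p' I \<noteq> 0" "a \<in> I" "b \<in> I"
    define J where "J = I - {w}"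
    have J: "J \<in> Pow V" "p J \<noteq> 0" and vw: "v \<in> I \<longleftrightarrow> w \<in> I"
      using I(1,2) by (auto simp: p'_def J_def split: if_splits)
    show "\<not> E a b"
    proof
      assume ab: "E a b"
      consider "a = w" "b = w" | "a = w" "b \<noteq> w" | "a \<noteq> w" "b = w" | "a \<noteq> w" "b \<noteq> w" by blast
      then show False
      proof cases
        case 1 then show ?thesis using ab nadj by simp
      next
        case 2
        then have "v \<in> J" "b \<in> J" using I vw V by (auto simp: J_def)
        then show ?thesis using pst[OF J, of v b] E'(2)[of b] ab 2 J(1) by auto
      next
        case 3
        then have "v \<in> J" "a \<in> J" using I vw V by (auto simp: J_def)
        then show ?thesis using pst[OF J, of v a] E'(2)[of a] ab 3 J(1) by auto
      next
        case 4
        then have "a \<in> J" "b \<in> J" using I by (auto simp: J_def)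
        then show ?thesis using pst[OF J, of a b] E'(1)[of a b] ab J(1) by auto
      qed
    qed
  qed
  have c1: "cover (insert w V) p' W = cover V p W" if "W \<subseteq> V" for W
  proof -
    have "W \<subseteq> insert w I \<longleftrightarrow> W \<subseteq> I" for I using that V(2) by auto
    then show ?thesis
      unfolding cover_def sum_Pow_insert[OF V(1,2)] by (intro sum.cong) (auto simp: out inn)
  qed
  have vw: "v \<noteq> w" using V by auto
  have c2: "cover (insert w V) p' {w} = cover V p {v}"
    unfolding cover_def sum_Pow_insert[OF V(1,2)] using V by (intro sum.cong) (auto simp: inn)
  have c3: "cover (insert w V) p' {v, w} = cover V p {v}"
    unfolding cover_def sum_Pow_insert[OF V(1,2)] using V vw by (intro sum.cong) (auto simp: inn)
  show thesis using that st c1 c2 c3 by blast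
qed

text \<open>The unit interval is cut into consecutive pieces, one of length \<open>p I\<close> for
  each \<open>I\<close>, and a vertex receives the pieces of the sets containing it.\<close>

lemma f_coloring_of_colorable:
  assumes V: "finite V" and c: "colorable V E f"
  shows "\<exists>\<phi>. f_coloring V E f \<phi>"
proof -
  from c obtain p where p: "stable_dist V E p" and cov: "\<And>v. v \<in> V \<Longrightarrow> cover V p {v} = f v"
    unfolding colorable_def by auto
  have pnn: "0 \<le> p I" for I using p unfolding stable_dist_def by auto
  define n where "n = card (Pow V)"
  obtain h where h: "bij_betw h {..<n} (Pow V)"
    using ex_bij_betw_nat_finite[of "Pow V"] V by (auto simp: n_def atLeast0LessThan)
  define S where "S i = (\<Sum>j<i. p (h j))" for i :: nat
  have S_mono: "i \<le> j \<Longrightarrow> S i \<le> S j" for i j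
    unfolding S_def using pnn by (intro sum_mono2) auto
  have Sn: "S n = 1"
    using p sum.reindex_bij_betw[OF h, of p] unfolding S_def stable_dist_def by simp
  have S0: "S 0 = 0" by (simp add: S_def)
  have disj: "{S i..<S (Suc i)} \<inter> {S j..<S (Suc j)} = {}" if "i \<noteq> j" for i j
    using that S_mono[of "Suc i" j] S_mono[of "Suc j" i] by (cases "i < j") auto
  define C where "C v = {i. i < n \<and> v \<in> h i}" for v
  define \<phi> where "\<phi> v = (\<Union>i\<in>C v. {S i..<S (Suc i)})" for v
  have fin: "finite (C v)" for v by (simp add: C_def)
  have meas: "measure lebesgue (\<phi> v) = f v" if "v \<in> V" for v
  proof -
    have "measure lebesgue (\<phi> v) = (\<Sum>i\<in>C v. measure lebesgue {S i..<S (Suc i)})"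
      unfolding \<phi>_def
    proof (intro measure_finite_Union fin)
      show "disjoint_family_on (\<lambda>i. {S i..<S (Suc i)}) (C v)"
        using disj by (simp only: disjoint_family_on_def) blast
      show "emeasure lebesgue {S i..<S (Suc i)} \<noteq> \<infinity>" for i
        using S_mono[of i "Suc i"] by simp
    qed auto
    also have "\<dots> = (\<Sum>i\<in>C v. p (h i))"
      using pnn by (intro sum.cong) (simp_all add: S_def)
    also have "\<dots> = (\<Sum>i<n. p (h i) * of_bool ({v} \<subseteq> h i))"
      unfolding C_def by (intro sum.mono_neutral_cong_left) auto
    also have "\<dots> = cover V p {v}"
      unfolding cover_def by (rule sum.reindex_bij_betw[OF h])
    finally show ?thesis using cov that by simp
  qed
  have sub: "\<phi> v \<subseteq> {0..1}" for v
  proof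
    fix y assume "y \<in> \<phi> v"
    then obtain i where "i < n" "S i \<le> y" "y < S (Suc i)" by (auto simp: \<phi>_def C_def)
    then show "y \<in> {0..1}" using S_mono[of 0 i] S_mono[of "Suc i" n] Sn S0 by auto
  qed
  have sep: "\<phi> u \<inter> \<phi> v = {}" if uv: "E u v" for u v
  proof (rule ccontr)
    assume "\<phi> u \<inter> \<phi> v \<noteq> {}"
    then obtain y i j where i: "i \<in> C u" "y \<in> {S i..<S (Suc i)}" and j: "j \<in> C v" "y \<in> {S j..<S (Suc j)}"
      unfolding \<phi>_def by blast
    then have "i = j" using disj[of i j] by blast
    then have "u \<in> h i" "v \<in> h i" "i < n" using i j by (auto simp: C_def)
    moreover from this have "h i \<in> Pow V" using h by (auto simp: bij_betw_def)
    \<comment> \<open>A set containing the edge \<open>u v\<close> has probability 0, so its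
      half-open piece is empty and cannot contain \<open>y\<close>.\<close>
    ultimately have "p (h i) = 0" using p uv unfolding stable_dist_def by blast
    then show False using i(2) by (simp add: S_def)
  qed
  have "\<phi> v \<in> sets lebesgue" for v
    unfolding \<phi>_def using fin by (intro sets.finite_UN) auto
  then have "f_coloring V E f \<phi>"
    unfolding f_coloring_def fractional_coloring_def using sub sep meas by auto
  then show ?thesis by blast
qed

section \<open>The inequality behind the identification step\<close>

text \<open>With \<open>r\<close> and \<open>P\<close> as below, the left side is the concave
  quadratic \<open>(r - a / s) * (a + P)\<close> in \<open>a\<close>. The case \<open>a = 0\<close>
  is a quadratic inequality in \<open>b\<close>; for larger \<open>a\<close> the product is
  nonpositive, or at most \<open>r * P\<close>, or at most \<open>r * r * s\<close>.\<close>

lemma mixing_inequality_core: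
  fixes s a b :: real
  assumes s: "7/2 \<le> s" and a: "0 \<le> a" and b: "0 \<le> b"
  shows "((s - b) / (s + b) - a / s) * (a + 2 * b + s / 3 + 13/6) \<le> 4 * s / 3 - 1"
proof -
  define r where "r = (s - b) / (s + b)"
  define P where "P = 2 * b + s / 3 + 13/6"
  have sp: "0 < s" "0 < s + b" and P: "0 < P" using s b by (auto simp: P_def)
  have r1: "r \<le> 1" using sp b by (simp add: r_def divide_le_eq_1)
  have rP: "r * P \<le> 4 * s / 3 - 1"
  proof -
    \<comment> \<open>Completing the square in \<open>b\<close>; the remainder is nonnegative
      because \<open>s \<ge> 7/2\<close>.\<close>
    have "(4 * s / 3 - 1) * (s + b) - (s - b) * P =
        2 * (b - (s - 7/2) / 12)\<^sup>2 + (s * (s - 19/6) - (s - 7/2) * (s - 7/2) / 72)"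
      by (simp add: P_def power2_eq_square field_simps)
    moreover have "(s - 7/2) * (s - 7/2) \<le> s * (s - 19/6)"
      using s by (intro mult_mono) auto
    moreover have "0 \<le> (s - 7/2) * (s - 7/2)" "0 \<le> (b - (s - 7/2) / 12)\<^sup>2" by simp_all
    moreover have "y \<le> x" if "x - y = 2 * A + (B - C / 72)" "C \<le> B" "0 \<le> C" "0 \<le> A" for x y A B C :: real
      using that by linarith
    ultimately have "(s - b) * P \<le> (4 * s / 3 - 1) * (s + b)" by blast
    then show ?thesis using sp by (simp add: r_def divide_le_eq)
  qed
  have "(r - a / s) * (a + P) \<le> 4 * s / 3 - 1"
  proof -
    consider "r \<le> a / s" | "a / s < r" "r \<le> P / s" | "a / s < r" "P / s < r" by linarith
    then show ?thesis
    proof cases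
      case 1
      then have "(r - a / s) * (a + P) \<le> 0" using a P by (intro mult_nonpos_nonneg) auto
      then show ?thesis using s by linarith
    next
      case 2
      have "(r - a / s) * (a + P) = r * P + a * (r - P / s) - a * a / s"
        by (simp add: algebra_simps add_divide_distrib)
      moreover have "a * (r - P / s) \<le> 0" using 2 a by (intro mult_nonneg_nonpos) auto
      moreover have "0 \<le> a * a / s" using a sp by simp
      ultimately show ?thesis using rP by linarith
    next
      case 3
      then have "P \<le> r * s" using sp by (simp add: divide_less_eq)
      then have "(r - a / s) * (a + P) \<le> (r - a / s) * (a + r * s)"
        using 3 by (intro mult_left_mono) auto
      also have "\<dots> = r * r * s - a * a / s" using sp by (simp add: field_simps)
      also have "\<dots> \<le> r * r * s" using sp by simp
      also have "\<dots> \<le> 1 * 1 * s"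
      proof -
        have "0 \<le> a / s" using a sp by simp
        then have "0 \<le> r" using 3 by linarith
        then show ?thesis using r1 sp by (intro mult_right_mono mult_mono) auto
      qed
      also have "\<dots> \<le> 4 * s / 3 - 1" using s by simp
      finally show ?thesis .
    qed
  qed
  then show ?thesis by (simp add: r_def P_def add.assoc)
qed

text \<open>The first summand is the weight of the coloring with \<open>v1\<close> and
  \<open>v2\<close> identified, where \<open>q\<close> is their overlap. The inequality says that
  what is left of the demand of \<open>v1\<close> fits into the remaining weight.\<close>

lemma mixing_inequality:
  fixes s D1 D2 t q :: real
  assumes s: "7/2 \<le> s" and D: "s \<le> D1" "s \<le> D2" and t: "2 * s - 1 \<le> 3 * t"
    and q: "0 \<le> q" "q \<le> 1 / D1 + 1 / D2 - 3 / (2 * s)"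
  shows "q * (2 * (D1 + D2 - s - t + 1/2) + 1) + (1 / D1 - q) * (D1 - 1/2 - t + 2/3) \<le> 1"
proof -
  define a b where "a = D1 - s" and "b = D2 - s"
  \<comment> \<open>Bounds the total coefficient of \<open>q\<close> on the left side, with
    \<open>t\<close> replaced by its lower bound \<open>(2 * s - 1) / 3\<close>.\<close>
  define M where "M = a + 2 * b + s / 3 + 13/6"
  have ab: "0 \<le> a" "0 \<le> b" and sp: "0 < s" "0 < D1" "0 < D2" using D s by (auto simp: a_def b_def)
  have D1: "D1 = s + a" and D2: "D2 = s + b" by (auto simp: a_def b_def)
  have "q * D1 \<le> (1 / D1 + 1 / D2 - 3 / (2 * s)) * D1"
    using q sp by (intro mult_right_mono) auto
  also have "\<dots> = 1 + D1 / D2 - 3 * D1 / (2 * s)" using sp by (simp add: field_simps)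
  also have "D1 / D2 \<le> s / (s + b) + a / s"
  proof -
    have "D1 / D2 = s / (s + b) + a / (s + b)" by (simp add: D1 D2 add_divide_distrib)
    moreover have "a / (s + b) \<le> a / s" using ab sp by (intro divide_left_mono) auto
    ultimately show ?thesis by simp
  qed
  finally have "q * D1 \<le> 1 + (s / (s + b) + a / s) - 3 * D1 / (2 * s)" by simp
  also have "\<dots> = ((s - b) / (s + b) - a / s) / 2"
  proof -
    have "(s - b) / (s + b) = 2 * (s / (s + b)) - 1" using sp ab by (simp add: field_simps)
    moreover have "3 * D1 / (2 * s) = 3/2 + 3/2 * (a / s)" using sp by (simp add: D1 field_simps)
    ultimately show ?thesis by simp
  qed
  finally have qD: "q * D1 \<le> ((s - b) / (s + b) - a / s) / 2" .
  have M: "0 \<le> M" using ab s by (simp add: M_def)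
  have "q * D1 * M \<le> ((s - b) / (s + b) - a / s) / 2 * M"
    using qD M by (rule mult_right_mono)
  also have "\<dots> \<le> (4 * s / 3 - 1) / 2"
    using mixing_inequality_core[OF s ab] by (simp add: M_def)
  also have "\<dots> \<le> t - 1/6" using t by simp
  finally have "q * M \<le> (t - 1/6) / D1" using sp by (simp add: field_simps)
  moreover have "q * (D1 + 2 * D2 - 2 * s - t + 11/6) \<le> q * M"
    using q(1) t by (intro mult_left_mono) (auto simp: M_def a_def b_def)
  moreover have "q * (2 * (D1 + D2 - s - t + 1/2) + 1) + (1 / D1 - q) * (D1 - 1/2 - t + 2/3)
      = q * (D1 + 2 * D2 - 2 * s - t + 11/6) + 1 - (t - 1/6) / D1"
    using sp by (simp add: field_simps)
  ultimately show ?thesis by linarith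
qed

section \<open>Graphs without simplicial vertices\<close>

text \<open>The hypotheses for \<open>\<epsilon> = 1/2\<close> as the induction carries them, with
  the degree bound cleared of its denominator. Edges may leave \<open>V\<close>, so that vertices
  can be deleted without changing \<open>E\<close>.\<close>

definition admissible :: "'a set \<Rightarrow> ('a \<Rightarrow> 'a \<Rightarrow> bool) \<Rightarrow> ('a \<Rightarrow> real) \<Rightarrow> bool" where
  "admissible V E f \<longleftrightarrow> finite V \<and> (\<forall>u v. E u v \<longrightarrow> E v u) \<and> (\<forall>v. \<not> E v v) \<and>
     (\<forall>v\<in>V. 0 \<le> f v \<and> f v * (real (degree V E v) + 1/2) \<le> 1) \<and>
     (\<forall>K. clique V E K \<longrightarrow> sum f K \<le> 1)"

lemma degree_subset: "finite V \<Longrightarrow> V' \<subseteq> V \<Longrightarrow> degree V' E v \<le> degree V E v"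
  unfolding degree_def by (intro card_mono) auto

lemma clique_subset: "clique V E K \<Longrightarrow> V \<subseteq> V' \<Longrightarrow> clique V' E K"
  unfolding clique_def by auto

lemma admissible_subset:
  assumes "admissible V E f" "V' \<subseteq> V"
  shows "admissible V' E f"
  unfolding admissible_def
proof (intro conjI ballI)
  fix v assume v: "v \<in> V'"
  have "f v * (real (degree V' E v) + 1/2) \<le> f v * (real (degree V E v) + 1/2)"
    using assms v degree_subset[of V V' E v] unfolding admissible_def by (intro mult_left_mono) auto
  then show "f v * (real (degree V' E v) + 1/2) \<le> 1"
    using assms v unfolding admissible_def by fastforce
qed (use assms clique_subset[of V' E _ V] finite_subset[of V' V] in \<open>auto simp: admissible_def\<close>)

text \<open>What remains when the greedy step fails at every vertex, expressed without the original
  demands. The induction hypothesis \<open>smaller\<close> leaves the adjacency relation free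
  because identifying vertices changes it.\<close>

locale minimal_graph =
  fixes V :: "'a set" and E :: "'a \<Rightarrow> 'a \<Rightarrow> bool"
  assumes fin: "finite V" and sym: "E u v \<Longrightarrow> E v u" and irr: "\<not> E v v"
    and not_simplicial: "x \<in> V \<Longrightarrow> \<not> clique V E (insert x {u \<in> V. E x u})"
    and excess: "x \<in> V \<Longrightarrow> 1 < (\<Sum>u\<in>insert x {u \<in> V. E x u}. 1 / (real (degree V E u) + 1/2))"
    and smaller: "card V' < card V \<Longrightarrow> admissible (V' :: 'a set) E' f' \<Longrightarrow> colorable V' E' f'"
begin

abbreviation d :: "'a \<Rightarrow> nat" where "d \<equiv> degree V E"
abbreviation N :: "'a \<Rightarrow> 'a set" where "N x \<equiv> {u \<in> V. E x u}"
abbreviation C :: "'a \<Rightarrow> 'a set" where "C x \<equiv> insert x (N x)"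

definition F :: "'a \<Rightarrow> real" where "F v = 1 / (real (d v) + 1/2)"

text \<open>The gap between \<open>F\<close> and the bound that applies once a neighbour has been deleted.\<close>

definition \<rho> :: "'a \<Rightarrow> real" where "\<rho> v = 1 / ((real (d v) - 1/2) * (real (d v) + 1/2))"

text \<open>Deleting a pivot of \<open>u\<close> makes \<open>u\<close> simplicial.\<close>

definition pivot :: "'a \<Rightarrow> 'a \<Rightarrow> bool" where
  "pivot u v \<longleftrightarrow> v \<in> N u \<and> clique V E (C u - {v})"

definition two_pivots :: "'a \<Rightarrow> bool" where
  "two_pivots u \<longleftrightarrow> (\<exists>v w. v \<noteq> w \<and> pivot u v \<and> pivot u w)"

lemma finite_N [simp]: "finite (N x)" using fin by auto

lemma card_C: "card (C x) = d x + 1"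
  using irr by (simp add: degree_def)

lemma F_pos: "0 < F v" by (simp add: F_def)

lemma clique_C:
  assumes "clique V E K" "u \<in> K" shows "K \<subseteq> C u"
  using assms unfolding clique_def by auto

text \<open>\<open>K\<close> is contained in \<open>C u\<close>, which has \<open>d u + 1\<close>
  elements and is not itself a clique.\<close>

lemma clique_card_le_degree:
  assumes K: "clique V E K" "u \<in> K"
  shows "card K \<le> d u"
proof (rule ccontr)
  assume "\<not> card K \<le> d u"
  then have "K = C u"
    using clique_C[OF K] card_C[of u] by (intro card_seteq) auto
  then have "clique V E (C u)" using K(1) by metis
  moreover have "u \<in> V" using K unfolding clique_def by blast
  ultimately show False using not_simplicial by blast
qed

lemma d_pos: "u \<in> V \<Longrightarrow> 1 \<le> d u"
  using clique_card_le_degree[of "{u}" u] by (simp add: clique_def)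

lemma F_le: "k \<le> d u \<Longrightarrow> F u \<le> 1 / (real k + 1/2)"
  unfolding F_def by (intro divide_left_mono) auto

text \<open>Shows that \<open>F\<close> satisfies the clique condition automatically, with room to
  spare.\<close>

lemma sum_F_clique:
  assumes "clique V E K"
  shows "sum F K \<le> real (card K) / (real (card K) + 1/2)"
proof -
  have "sum F K \<le> real (card K) * (1 / (real (card K) + 1/2))"
    by (intro sum_bounded_above F_le clique_card_le_degree[OF assms])
  then show ?thesis by simp
qed

lemma F_rho: "u \<in> V \<Longrightarrow> F u = (real (d u) - 1/2) * \<rho> u"
  using d_pos[of u] by (simp add: F_def \<rho>_def)

lemma F_plus_rho: "u \<in> V \<Longrightarrow> F u + \<rho> u = 1 / (real (d u) - 1/2)"
proof -
  assume "u \<in> V"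
  then have "0 < real (d u) - 1/2" using d_pos[of u] by simp
  moreover have "1 / (a + 1) + 1 / (a * (a + 1)) = 1 / a" if "0 < a" for a :: real
  proof -
    have "1 / (a * (a + 1)) = 1 / a - 1 / (a + 1)" using that by (simp add: diff_frac_eq)
    then show ?thesis by simp
  qed
  from this[of "real (d u) - 1/2"] calculation show ?thesis by (simp add: F_def \<rho>_def add.commute)
qed

lemma rho_pos: "u \<in> V \<Longrightarrow> 0 < \<rho> u"
  using d_pos[of u] by (simp add: \<rho>_def)

text \<open>
  The raise of \<open>u\<close> when \<open>v\<close> is deleted. It must sum to \<open>F u = (d u - 1/2) * \<rho> u\<close> over the neighbours
  \<open>v\<close>, so half of \<open>\<rho> u\<close> may be given up, shared between the pivots of \<open>u\<close>.
\<close>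

definition r :: "'a \<Rightarrow> 'a \<Rightarrow> real" where
  "r v u = (if pivot u v then if two_pivots u then 3/4 else 1/2 else 1) * \<rho> u"

text \<open>Given three pivots of \<open>u\<close>, any two vertices of \<open>C u\<close> avoid one
  of them and are therefore adjacent, which would make \<open>C u\<close> a clique.\<close>

lemma card_pivot:
  assumes u: "u \<in> V"
  shows "card {v. pivot u v} \<le> 2" "\<not> two_pivots u \<Longrightarrow> card {v. pivot u v} \<le> 1"
proof -
  have fy: "finite {v. pivot u v}"
    by (rule finite_subset[OF _ fin]) (auto simp: pivot_def)
  show "card {v. pivot u v} \<le> 2"
  proof (rule ccontr)
    assume "\<not> card {v. pivot u v} \<le> 2"
    then obtain S where S: "S \<subseteq> {v. pivot u v}" "card S = 3"
      using obtain_subset_with_card_n[of 3 "{v. pivot u v}"] by (metis not_less_eq_eq numeral_2_eq_2 numeral_3_eq_3)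
    then obtain a b c where "S = {a, b, c}" "a \<noteq> b" "b \<noteq> c" "a \<noteq> c" by (auto simp: card_3_iff)
    then have t: "pivot u a" "pivot u b" "pivot u c" "a \<noteq> b" "b \<noteq> c" "a \<noteq> c" using S by auto
    have "E y z" if yz: "y \<in> C u" "z \<in> C u" "y \<noteq> z" for y z
    proof -
      obtain w where w: "pivot u w" "w \<noteq> y" "w \<noteq> z" using t by metis
      then have "y \<in> C u - {w}" "z \<in> C u - {w}" using yz by auto
      then show ?thesis using w(1) yz(3) unfolding pivot_def clique_def by blast
    qed
    then have "clique V E (C u)" using u unfolding clique_def by blast
    then show False using not_simplicial[OF u] by contradiction
  qed
  show "card {v. pivot u v} \<le> 1" if "\<not> two_pivots u"
  proof -
    have "\<forall>a\<in>{v. pivot u v}. \<forall>b\<in>{v. pivot u v}. a = b" using that unfolding two_pivots_def by blast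
    then show ?thesis using card_le_Suc0_iff_eq[OF fy] by simp
  qed
qed

lemma sum_r:
  assumes u: "u \<in> V"
  shows "F u \<le> (\<Sum>v\<in>N u. r v u)"
proof -
  \<comment> \<open>The share of \<open>\<rho> u\<close> given up at one pivot; by
    \<open>card_pivot\<close> the total given up is at most one half.\<close>
  define w :: real where "w = (if two_pivots u then 1/4 else 1/2)"
  have "(\<Sum>v\<in>N u. r v u) = (\<Sum>v\<in>N u. \<rho> u - w * \<rho> u * of_bool (pivot u v))"
    by (intro sum.cong) (auto simp: r_def w_def)
  also have "\<dots> = real (d u) * \<rho> u - w * \<rho> u * card {v. pivot u v}"
  proof -
    have "(\<Sum>v\<in>N u. of_bool (pivot u v) :: real) = card (N u \<inter> {v. pivot u v})"
      by (simp add: of_bool_def sum.If_cases)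
    also have "N u \<inter> {v. pivot u v} = {v. pivot u v}" by (auto simp: pivot_def)
    finally show ?thesis by (simp add: sum_subtractf sum_distrib_left[symmetric] degree_def)
  qed
  also have "\<dots> = (real (d u) - w * card {v. pivot u v}) * \<rho> u" by (simp add: algebra_simps)
  also have "\<dots> \<ge> (real (d u) - 1/2) * \<rho> u"
    using card_pivot[OF u] rho_pos[OF u] by (intro mult_right_mono) (auto simp: w_def)
  finally show ?thesis using F_rho[OF u] by simp
qed

section \<open>Averaging over vertex-deleted subgraphs\<close>

definition h :: "'a \<Rightarrow> 'a \<Rightarrow> real" where
  "h v u = F u + (if E u v then r v u else 0)"

lemma r_bounds: "u \<in> V \<Longrightarrow> 0 \<le> r v u \<and> r v u \<le> \<rho> u"
  using rho_pos[of u] by (cases "pivot u v"; cases "two_pivots u") (auto simp: r_def)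

text \<open>Both sides have \<open>card K + 1\<close> elements and one inclusion is clear. This
  describes the vertices at which \<open>K\<close> obstructs a full raise.\<close>

lemma C_eq_insert_clique:
  assumes K: "clique V E K" and v: "v \<in> V" "v \<notin> K" and u: "u \<in> K" "E u v" "d u = card K"
  shows "C u = insert v K"
proof -
  have "insert v K \<subseteq> C u" using clique_C[OF K u(1)] v(1) u(2) by blast
  moreover have "card (insert v K) = card (C u)"
    using card_C[of u] u(3) v(2) finite_subset[OF clique_C[OF K u(1)]] by simp
  ultimately show ?thesis using card_subset_eq[of "C u" "insert v K"] by simp
qed

text \<open>Demands of size \<open>x\<close> would leave a slack of \<open>x / 2\<close> on
  \<open>K\<close>. Only the vertices of \<open>T\<close> can exceed \<open>x\<close>; they are
  twins with pivot \<open>v\<close>, and their number is limited by \<open>few\<close> or by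
  \<open>T \<noteq> K\<close>.\<close>

lemma sum_h_clique:
  assumes few: "\<And>u. u \<in> V \<Longrightarrow> two_pivots u \<Longrightarrow> 3 * card {y \<in> V. C y = C u} + 1 \<le> 2 * d u"
    and v: "v \<in> V" and K: "clique V E K" "v \<notin> K"
  shows "sum (h v) K \<le> 1"
proof -
  define k where "k = card K"
  define T where "T = {u \<in> K. E u v \<and> d u = k}"
  have KV: "K \<subseteq> V" using K(1) by (simp add: clique_def)
  have finK: "finite K" by (rule finite_subset[OF KV fin])
  have dk: "k \<le> d u" if "u \<in> K" for u using clique_card_le_degree[OF K(1) that] by (simp add: k_def)
  have CT: "C u = insert v K" if "u \<in> T" for u
    using C_eq_insert_clique[OF K(1) v K(2)] that by (auto simp: T_def k_def)
  have pivotT: "pivot u v" if "u \<in> T" for u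
  proof -
    have "C u - {v} = K" using CT[OF that] K(2) by auto
    then show ?thesis using that v K(1) unfolding pivot_def T_def by auto
  qed
  define x where "x = 1 / (real k + 1/2)"
  define y where "y = 1 / ((real k - 1/2) * (real k + 1/2))"
  have outT: "h v u \<le> x" if u: "u \<in> K" "u \<notin> T" for u
  proof (cases "E u v")
    case True
    then have "k + 1 \<le> d u" using u dk[of u] by (auto simp: T_def)
    then have "1 / (real (d u) - 1/2) \<le> x" unfolding x_def by (intro divide_left_mono) auto
    moreover have "u \<in> V" using u KV by auto
    ultimately show ?thesis using True F_plus_rho[of u] r_bounds[of u v] by (simp add: h_def)
  next
    case False
    then show ?thesis using F_le[OF dk[OF u(1)]] by (simp add: h_def x_def)
  qed
  have inT: "h v u = x + (if two_pivots u then 3/4 else 1/2) * y" if "u \<in> T" for u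
    using pivotT[OF that] that by (auto simp: h_def r_def F_def \<rho>_def x_def y_def T_def)
  have TK: "T \<subseteq> K" by (auto simp: T_def)
  show ?thesis
  proof (cases "T = {}")
    case True
    then have "sum (h v) K \<le> real k * x"
      using outT sum_bounded_above[of K "h v" x] by (simp add: k_def)
    also have "\<dots> \<le> 1" by (simp add: x_def)
    finally show ?thesis .
  next
    case False
    then obtain u0 where u0: "u0 \<in> T" by auto
    have k1: "1 \<le> k" using u0 TK finK by (auto simp: k_def Suc_le_eq card_gt_0_iff)
    have yp: "0 < y" using k1 by (simp add: y_def)
    \<comment> \<open>Otherwise all of \<open>K\<close> would be adjacent to \<open>v\<close>, and
      \<open>C u0 = insert v K\<close> would be a clique.\<close>
    have "T \<noteq> K"
    proof
      assume "T = K"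
      then have "clique V E (C u0)"
        using K(1) v sym unfolding CT[OF u0] clique_def T_def by blast
      then show False using not_simplicial[of u0] u0 TK KV by blast
    qed
    then have "card T < k" using TK finK by (auto simp: k_def intro!: psubset_card_mono)
    then have t1: "real (card T) \<le> real k - 1" by linarith
    have t2: "3 * real (card T) + 1 \<le> 2 * real k" if u: "u \<in> T" "two_pivots u" for u
    proof -
      have "T \<subseteq> {y \<in> V. C y = C u}" using CT[OF u(1)] CT TK KV by blast
      then have "card T \<le> card {y \<in> V. C y = C u}" using fin by (intro card_mono) auto
      moreover have "u \<in> V" "d u = k" using u TK KV by (auto simp: T_def)
      ultimately show ?thesis using few[of u] u(2) by simp
    qed
    define w :: real where "w = (if \<exists>u\<in>T. two_pivots u then 3/4 else 1/2)"
    \<comment> \<open>For \<open>w = 3/4\<close> this is exactly the bound supplied by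
      \<open>few\<close>; for \<open>w = 1/2\<close> the bound \<open>card T \<le> k - 1\<close>
      suffices.\<close>
    have tw: "real (card T) * w \<le> (real k - 1/2) / 2"
    proof (cases "\<exists>u\<in>T. two_pivots u")
      case True
      then have "3 * real (card T) + 1 \<le> 2 * real k" using t2 by blast
      then show ?thesis using True by (simp add: w_def)
    next
      case False
      then have w: "w = 1/2" unfolding w_def by (rule if_not_P)
      show ?thesis unfolding w using t1 by simp
    qed
    have "sum (h v) K = sum (h v) T + sum (h v) (K - T)"
      using TK finK by (simp add: sum.subset_diff add.commute)
    also have "sum (h v) T \<le> real (card T) * (x + w * y)"
    proof (rule sum_bounded_above)
      fix u assume u: "u \<in> T"
      have "(if two_pivots u then 3/4 else 1/2) * y \<le> w * y"
        using yp u by (intro mult_right_mono) (auto simp: w_def)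
      then show "h v u \<le> x + w * y" using inT[OF u] by simp
    qed
    also have "sum (h v) (K - T) \<le> real (card (K - T)) * x"
      using outT by (intro sum_bounded_above) auto
    also have "real (card (K - T)) = real k - real (card T)"
      using TK finK finite_subset[OF TK finK] by (simp add: k_def card_Diff_subset of_nat_diff card_mono)
    also have "real (card T) * (x + w * y) + (real k - real (card T)) * x
        = real k * x + real (card T) * w * y" by (simp add: algebra_simps)
    also have "\<dots> \<le> real k * x + (real k - 1/2) / 2 * y"
      using tw yp by (intro add_left_mono mult_right_mono) auto
    also have "\<dots> = (real k + 1/2) * x"
    proof -
      have "(real k - 1/2) * y = x" using k1 by (simp add: x_def y_def)
      then show ?thesis by (simp add: algebra_simps)
    qed
    also have "\<dots> = 1" by (simp add: x_def)
    finally show ?thesis by simp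
  qed
qed

text \<open>A vertex \<open>u\<close> gets nothing from the coloring that omits it, but its raises
  over the other colorings sum to at least \<open>F u\<close> by \<open>sum_r\<close>.\<close>

lemma colorable_by_averaging:
  assumes few: "\<And>u. u \<in> V \<Longrightarrow> two_pivots u \<Longrightarrow> 3 * card {y \<in> V. C y = C u} + 1 \<le> 2 * d u"
    and ne: "V \<noteq> {}"
  shows "colorable V E F"
proof -
  define n where "n = real (card V)"
  have n: "0 < n" using ne fin by (simp add: n_def card_gt_0_iff)
  have "\<exists>p. stable_dist V E p \<and> (\<forall>u\<in>V. cover V p {u} = (if u = v then 0 else h v u))" if v: "v \<in> V" for v
  proof -
    have "admissible (V - {v}) E (h v)"
      unfolding admissible_def
    proof (intro conjI ballI allI impI)
      show "E a b \<Longrightarrow> E b a" "\<not> E a a" for a b using sym irr by auto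
      fix u assume u: "u \<in> V - {v}"
      then have uV: "u \<in> V" by auto
      show "0 \<le> h v u" using r_bounds[OF uV, of v] F_pos[of u] by (simp add: h_def)
      show "h v u * (real (degree (V - {v}) E u) + 1/2) \<le> 1"
      proof (cases "E u v")
        case True
        have "{w \<in> V - {v}. E u w} = N u - {v}" by auto
        then have "degree (V - {v}) E u = d u - 1" using True v by (simp add: degree_def)
        then have deg: "real (degree (V - {v}) E u) + 1/2 = real (d u) - 1/2" using d_pos[OF uV] by simp
        have "h v u \<le> 1 / (real (d u) - 1/2)"
          using True F_plus_rho[OF uV] r_bounds[OF uV, of v] by (simp add: h_def)
        then show ?thesis unfolding deg using d_pos[OF uV] by (simp add: le_divide_eq)
      next
        case False
        then have "{w \<in> V - {v}. E u w} = N u" by blast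
        then show ?thesis using False by (simp add: degree_def h_def F_def)
      qed
    next
      fix K assume "clique (V - {v}) E K"
      then show "sum (h v) K \<le> 1"
        using sum_h_clique[OF few v] unfolding clique_def by auto
    qed (use fin in auto)
    then have "colorable (V - {v}) E (h v)"
      by (rule smaller[OF card_Diff1_less[OF fin v]])
    then obtain p where p: "stable_dist (V - {v}) E p" "\<forall>u\<in>V - {v}. cover (V - {v}) p {u} = h v u"
      unfolding colorable_def by auto
    obtain p' where "stable_dist V E p'"
      "\<And>W. cover V p' W = (if W \<subseteq> V - {v} then cover (V - {v}) p W else 0)"
      using stable_dist_lift[OF fin _ p(1)] by blast
    then show ?thesis using p(2) by (intro exI[of _ p']) auto
  qed
  then obtain P where P: "\<And>v. v \<in> V \<Longrightarrow> stable_dist V E (P v)"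
    "\<And>v u. v \<in> V \<Longrightarrow> u \<in> V \<Longrightarrow> cover V (P v) {u} = (if u = v then 0 else h v u)"
    by metis
  have st: "stable_dist V E (\<lambda>I. \<Sum>v\<in>V. 1 / n * P v I)"
    using P(1) n fin by (intro stable_dist_average) (auto simp: n_def)
  show ?thesis
  proof (rule colorable_trim[OF fin st])
    fix u assume u: "u \<in> V"
    have "cover V (\<lambda>I. \<Sum>v\<in>V. 1 / n * P v I) {u} = (\<Sum>v\<in>V. 1 / n * (if u = v then 0 else h v u))"
      unfolding cover_average using P(2) u by (intro sum.cong) auto
    also have "\<dots> = 1 / n * (\<Sum>v\<in>V - {u}. h v u)"
      unfolding sum_distrib_left using fin by (intro sum.mono_neutral_cong_right) auto
    also have "(\<Sum>v\<in>V - {u}. h v u) = (n - 1) * F u + (\<Sum>v\<in>V - {u}. if E u v then r v u else 0)"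
    proof -
      have "real (card (V - {u})) = n - 1"
        using card_Suc_Diff1[OF fin u] by (simp add: n_def flip: of_nat_Suc)
      then show ?thesis by (simp add: h_def sum.distrib)
    qed
    also have "(\<Sum>v\<in>V - {u}. if E u v then r v u else 0) = (\<Sum>v\<in>N u. r v u)"
      using fin irr by (intro sum.mono_neutral_cong_right) auto
    finally have "cover V (\<lambda>I. \<Sum>v\<in>V. 1 / n * P v I) {u} = 1 / n * ((n - 1) * F u + (\<Sum>v\<in>N u. r v u))" .
    moreover have "n * F u \<le> (n - 1) * F u + (\<Sum>v\<in>N u. r v u)"
      using sum_r[OF u] by (simp add: algebra_simps)
    ultimately show "0 \<le> F u \<and> F u \<le> cover V (\<lambda>I. \<Sum>v\<in>V. 1 / n * P v I) {u}"
      using n F_pos[of u] by (simp add: le_divide_eq mult.commute)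
  qed
qed


text \<open>If \<open>v1\<close> and \<open>v2\<close> overlap in measure
  \<open>q = sum F (C x) - 1\<close>, then the neighbours of a twin \<open>y\<close> of
  \<open>x\<close> occupy at most \<open>1 - F y\<close>, so all twins can be added greedily. The
  overlap comes from a mixture: with weight \<open>\<beta>\<close> a coloring of the graph with
  \<open>v1\<close> and \<open>v2\<close> merged, otherwise one in which they carry only their
  remaining demands.\<close>

lemma colorable_by_identification:
  assumes x: "x \<in> V" and piv: "pivot x v1" "pivot x v2" "v1 \<noteq> v2"
    and many: "2 * d x \<le> 3 * card {y \<in> V. C y = C x}"
  shows "colorable V E F"
proof -
  define T where "T = {y \<in> V. C y = C x}"
  define k where "k = d x"
  define t where "t = card T"
  define B where "B = C x - {v1, v2}"
  have vV: "v1 \<in> V" "v2 \<in> V" and vC: "v1 \<in> C x" "v2 \<in> C x" using piv by (auto simp: pivot_def)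
  \<comment> \<open>Every pair other than \<open>v1\<close>, \<open>v2\<close> misses one of the two
    pivots, so \<open>C x\<close> is a clique minus one edge.\<close>
  have cl: "E y z" if yz: "y \<in> C x" "z \<in> C x" "y \<noteq> z" "{y, z} \<noteq> {v1, v2}" for y z
  proof -
    obtain v where v: "pivot x v" "v \<noteq> y" "v \<noteq> z" using piv yz(3,4) by (metis insert_commute)
    then have "y \<in> C x - {v}" "z \<in> C x - {v}" using yz by auto
    then show ?thesis using v(1) yz(3) unfolding pivot_def clique_def by blast
  qed
  have nadj: "\<not> E v1 v2" "\<not> E v2 v1"
  proof -
    have "\<not> (E v1 v2 \<and> E v2 v1)"
    proof
      assume *: "E v1 v2 \<and> E v2 v1"
      have "clique V E (C x)"
        unfolding clique_def
      proof (intro conjI ballI impI)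
        show "C x \<subseteq> V" using x by auto
        fix y z assume "y \<in> C x" "z \<in> C x" "y \<noteq> z"
        then show "E y z" using cl[of y z] * by (metis doubleton_eq_iff)
      qed
      then show False using not_simplicial[OF x] by contradiction
    qed
    then show "\<not> E v1 v2" "\<not> E v2 v1" using sym by blast+
  qed
  have finT: "finite T" and TV: "T \<subseteq> V" using fin by (auto simp: T_def)
  have finB: "finite B" by (simp add: B_def)
  have TB: "T \<subseteq> B"
  proof
    fix y assume y: "y \<in> T"
    then have Cy: "C y = C x" by (simp add: T_def)
    then have "y \<in> C x" by blast
    moreover have "v1 \<in> C y" "v2 \<in> C y" using vC unfolding Cy by simp_all
    then have "y \<noteq> v1" "y \<noteq> v2" using nadj piv(3) by auto
    ultimately show "y \<in> B" by (simp add: B_def)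
  qed
  have xT: "x \<in> T" using x by (simp add: T_def)
  have CB: "C x = insert v1 (insert v2 B)" "v1 \<notin> B" "v2 \<notin> B" using vC by (auto simp: B_def)
  have "card (C x) = k + 1" using card_C by (simp add: k_def)
  then have "Suc (Suc (card B)) = k + 1" unfolding CB(1) using CB(2,3) finB piv(3) by simp
  then have cardB: "card B + 1 = k" by simp
  have tB: "t \<le> card B" using TB finB by (simp add: t_def card_mono)
  have many': "2 * k \<le> 3 * t" using many by (simp add: k_def t_def T_def)
  \<comment> \<open>From \<open>2 * k \<le> 3 * t \<le> 3 * (k - 1)\<close>; this is the source of
    the bound \<open>7/2 \<le> s\<close>.\<close>
  have k3: "3 \<le> k" using cardB tB many' by linarith
  have dC: "k \<le> d y" if y: "y \<in> C x" for y
  proof -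
    obtain v where v: "pivot x v" "v \<noteq> y" using piv by metis
    have "clique V E (C x - {v})" "v \<in> C x" using v(1) by (auto simp: pivot_def)
    moreover from this have "card (C x - {v}) = k" using card_C[of x] by (simp add: k_def)
    ultimately show ?thesis using clique_card_le_degree[of "C x - {v}" y] v(2) y by simp
  qed
  have BV: "B \<subseteq> V" using x by (auto simp: B_def)
  define s where "s = real k + 1/2"
  define D1 where "D1 = real (d v1) + 1/2"
  define D2 where "D2 = real (d v2) + 1/2"
  \<comment> \<open>Bounds the degree of the merged vertex after the removal of \<open>T\<close>:
    the \<open>k - 1 - t\<close> vertices of \<open>B - T\<close> are neighbours of both
    \<open>v1\<close> and \<open>v2\<close> and count once.\<close>
  define W where "W = D1 + D2 - s - real t + 1/2"
  \<comment> \<open>the overlap of the color sets of \<open>v1\<close> and \<open>v2\<close> that leaves enough room for \<open>T\<close>\<close>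
  define q where "q = sum F (C x) - 1"
  have q0: "0 < q" using excess[OF x] by (simp add: q_def F_def)
  have FD: "F v1 = 1 / D1" "F v2 = 1 / D2" by (simp_all add: F_def D1_def D2_def)
  have sD: "s \<le> D1" "s \<le> D2" using dC vC by (auto simp: s_def D1_def D2_def)
  have s3: "7/2 \<le> s" using k3 by (simp add: s_def)
  have sumC: "sum F (C x) = F v1 + F v2 + sum F B"
    unfolding CB(1) using CB(2,3) finB piv(3) by simp
  have "sum F B \<le> real (card B) * (1 / s)"
    unfolding s_def using dC by (intro sum_bounded_above F_le) (auto simp: B_def)
  also have "real (card B) = s - 3/2" using cardB by (simp add: s_def)
  finally have "sum F B \<le> 1 - 3 / (2 * s)" using s3 by (simp add: field_simps)
  then have q1: "q \<le> 1 / D1 + 1 / D2 - 3 / (2 * s)" using sumC FD by (simp add: q_def)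
  have tk: "2 * s - 1 \<le> 3 * real t" using many' by (simp add: s_def)
  have ineq1: "q * (2 * W + 1) + (F v1 - q) * (D1 - 1/2 - real t + 2/3) \<le> 1"
    using mixing_inequality[OF s3 sD tk _ q1] q0 by (simp add: W_def FD)
  have ineq2: "q * (2 * W + 1) + (F v2 - q) * (D2 - 1/2 - real t + 2/3) \<le> 1"
    using mixing_inequality[OF s3 sD(2,1) tk, of q] q0 q1 by (simp add: W_def FD add.commute)
  \<comment> \<open>\<open>c\<close> is the demand of the identified vertex, and \<open>\<beta> = q / c\<close> the weight of that coloring\<close>
  define \<beta> where "\<beta> = q * (2 * W + 1)"
  define c where "c = 1 / (2 * W + 1)"
  have tk2: "real t + 3/2 \<le> s" using tB cardB by (simp add: s_def)
  have n1: "1 \<le> D1 - 1/2 - real t" "1 \<le> D2 - 1/2 - real t" using tk2 sD by auto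
  have W1: "D1 - 1/2 - real t \<le> W" "D2 - 1/2 - real t \<le> W" using sD by (auto simp: W_def)
  have W0: "0 < W" using W1 n1 by linarith
  have invs: "1 / D1 \<le> 1 / s" "1 / D2 \<le> 1 / s" using sD s3 by (auto intro!: divide_left_mono)
  have "3 / (2 * s) = 3/2 * (1 / s)" "0 < 1 / s" using s3 by auto
  then have qF: "q < F v1" "q < F v2" using q1 invs FD by linarith+
  have \<beta>: "0 < \<beta>" "\<beta> < 1"
  proof -
    show "0 < \<beta>" using q0 W0 by (simp add: \<beta>_def)
    have "0 < (F v1 - q) * (D1 - 1/2 - real t + 2/3)" using qF n1 by (intro mult_pos_pos) auto
    then show "\<beta> < 1" using ineq1 unfolding \<beta>_def by linarith
  qed
  have \<beta>c: "\<beta> * c = q" using W0 by (simp add: \<beta>_def c_def)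
  have c0: "0 < c" using W0 by (simp add: c_def)

  define V2 where "V2 = V - T"
  define V1 where "V1 = V2 - {v2}"
  have v12: "v1 \<in> V1" "v2 \<in> V2" "v1 \<in> V2" and v2n: "v2 \<notin> V1"
    using vV TB piv(3) by (auto simp: V1_def V2_def B_def)
  have V2i: "V2 = insert v2 V1" using v12 by (auto simp: V1_def)
  have fin1: "finite V1" "finite V2" using fin by (auto simp: V1_def V2_def)
  have V12: "V1 \<subseteq> V" "V2 \<subseteq> V" by (auto simp: V1_def V2_def)
  have card1: "card V1 < card V" using fin vV v2n V12 by (intro psubset_card_mono) auto
  have card2: "card V2 < card V" using fin x xT V12 by (intro psubset_card_mono) (auto simp: V2_def)
  have BN: "B \<subseteq> N v" if v: "v \<in> {v1, v2}" for v
  proof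
    fix b assume b: "b \<in> B"
    have "E v b"
    proof (rule cl)
      show "v \<in> C x" "b \<in> C x" "v \<noteq> b" using v b vC by (auto simp: B_def)
      show "{v, b} \<noteq> {v1, v2}" using v b CB(2,3) by (auto simp: doubleton_eq_iff)
    qed
    then show "b \<in> N v" using b BV by auto
  qed
  have cardNT: "real (card (N v - T)) = real (d v) - real t" if "v \<in> {v1, v2}" for v
  proof -
    have "T \<subseteq> N v" using BN[OF that] TB by simp
    then show ?thesis using finT by (simp add: card_Diff_subset degree_def t_def of_nat_diff card_mono)
  qed

  \<comment> \<open>\<open>v1\<close> stands for the vertex obtained by identifying \<open>v1\<close> and \<open>v2\<close>\<close>
  define E1 where "E1 a b \<longleftrightarrow> E a b \<or> a = v1 \<and> E v2 b \<or> b = v1 \<and> E v2 a" for a b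
  define f1 where "f1 = F(v1 := c)"
  have N1: "real (card {u \<in> V1. E1 v1 u}) \<le> W"
  proof -
    let ?P = "N v1 - T" and ?Q = "N v2 - T"
    have "{u \<in> V1. E1 v1 u} \<subseteq> ?P \<union> ?Q"
      using nadj by (auto simp: E1_def V1_def V2_def)
    then have "card {u \<in> V1. E1 v1 u} \<le> card (?P \<union> ?Q)" by (intro card_mono) auto
    moreover have "card ?P + card ?Q = card (?P \<union> ?Q) + card (?P \<inter> ?Q)" by (intro card_Un_Int) auto
    moreover have "card (B - T) \<le> card (?P \<inter> ?Q)" using BN[of v1] BN[of v2] by (intro card_mono) auto
    moreover have "real (card (B - T)) = real (card B) - real t"
      using TB finT finB by (simp add: card_Diff_subset t_def of_nat_diff card_mono)
    ultimately show ?thesis using cardNT[of v1] cardNT[of v2] cardB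
      by (simp add: W_def D1_def D2_def s_def)
  qed
  have "admissible V1 E1 f1"
    unfolding admissible_def
  proof (intro conjI ballI allI impI)
    show "finite V1" by fact
    show "E1 a b \<Longrightarrow> E1 b a" for a b using sym by (auto simp: E1_def)
    show "\<not> E1 a a" for a using irr nadj by (auto simp: E1_def)
    fix b assume b: "b \<in> V1"
    show "0 \<le> f1 b" using c0 F_pos[of b] by (simp add: f1_def)
    show "f1 b * (real (degree V1 E1 b) + 1/2) \<le> 1"
    proof (cases "b = v1")
      case True
      have "real (degree V1 E1 v1) + 1/2 \<le> 2 * W + 1" using N1 W0 by (simp add: degree_def)
      then show ?thesis using True W0 by (simp add: f1_def c_def)
    next
      case False
      \<comment> \<open>Merging cannot raise the degree of another vertex: its new neighbours are
        images of old ones.\<close>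
      have "{u \<in> V1. E1 b u} \<subseteq> (\<lambda>u. if u = v2 then v1 else u) ` N b"
      proof
        fix u assume u: "u \<in> {u \<in> V1. E1 b u}"
        show "u \<in> (\<lambda>u. if u = v2 then v1 else u) ` N b"
        proof (cases "E b u")
          case True
          then have "u = (\<lambda>u. if u = v2 then v1 else u) u" "u \<in> N b" using u v2n V12 by auto
          then show ?thesis by (rule image_eqI)
        next
          case F: False
          then have "u = v1" "E b v2" using u False sym by (auto simp: E1_def)
          then show ?thesis using vV by (intro image_eqI[of _ _ v2]) auto
        qed
      qed
      then have "degree V1 E1 b \<le> card ((\<lambda>u. if u = v2 then v1 else u) ` N b)"
        unfolding degree_def by (intro card_mono) auto
      also have "\<dots> \<le> d b" unfolding degree_def by (intro card_image_le) auto
      finally have "degree V1 E1 b \<le> d b" .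
      then show ?thesis using False by (simp add: f1_def F_def)
    qed
  next
    fix K assume K: "clique V1 E1 K"
    have clG: "clique V E (K - {v1})"
      using K V12(1) unfolding clique_def E1_def by blast
    have finK: "finite K" using K fin1(1) by (auto simp: clique_def intro: finite_subset[of K V1])
    let ?k = "card (K - {v1})"
    have sF: "sum F (K - {v1}) \<le> real ?k / (real ?k + 1/2)" by (rule sum_F_clique[OF clG])
    show "sum f1 K \<le> 1"
    proof (cases "v1 \<in> K")
      case True
      have "u \<in> V1" "E1 v1 u" if "u \<in> K - {v1}" for u
        using that K True by (simp_all add: clique_def subset_iff not_sym)
      then have "K - {v1} \<subseteq> {u \<in> V1. E1 v1 u}" by (simp add: subset_iff)
      then have "?k \<le> card {u \<in> V1. E1 v1 u}" using fin1 by (intro card_mono) auto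
      then have kW: "real ?k \<le> W" using N1 by linarith
      have "sum f1 K = c + sum f1 (K - {v1})"
        using sum.remove[OF finK True, of f1] by (simp add: f1_def)
      also have "sum f1 (K - {v1}) = sum F (K - {v1})" by (intro sum.cong) (auto simp: f1_def)
      finally have "sum f1 K \<le> c + real ?k / (real ?k + 1/2)" using sF by simp
      also have "real ?k / (real ?k + 1/2) = 1 - 1 / (2 * real ?k + 1)" by (simp add: field_simps)
      \<comment> \<open>This determines the choice of \<open>c\<close>: it is the largest demand
        that fits beside a clique of \<open>W\<close> further vertices under the bound of
        \<open>sum_F_clique\<close>.\<close>
      also have "c \<le> 1 / (2 * real ?k + 1)" unfolding c_def using kW by (intro divide_left_mono) auto
      finally show ?thesis by simp
    next
      case False
      then have "sum f1 K = sum F (K - {v1})" by (intro sum.cong) (auto simp: f1_def)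
      also have "\<dots> \<le> 1" using sF by (rule order_trans) simp
      finally show ?thesis .
    qed
  qed
  then have "colorable V1 E1 f1" by (rule smaller[OF card1])
  then obtain p1 where p1: "stable_dist V1 E1 p1" "\<And>v. v \<in> V1 \<Longrightarrow> cover V1 p1 {v} = f1 v"
    unfolding colorable_def by auto
  obtain P1 where P1: "stable_dist V2 E P1"
    "\<And>W. W \<subseteq> V1 \<Longrightarrow> cover V2 P1 W = cover V1 p1 W"
    "cover V2 P1 {v2} = cover V1 p1 {v1}" "cover V2 P1 {v1, v2} = cover V1 p1 {v1}"
    unfolding V2i
    by (rule stable_dist_duplicate[OF fin1(1) v2n v12(1) p1(1), of E])
      (use irr sym in \<open>auto simp: E1_def\<close>)

  define f2 where "f2 = F(v1 := (F v1 - q) / (1 - \<beta>), v2 := (F v2 - q) / (1 - \<beta>))"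
  \<comment> \<open>The degree bound asks only for \<open>1/2\<close>; the larger constant
    \<open>2/3\<close> serves the clique condition below.\<close>
  have f2v: "0 \<le> f2 v \<and> f2 v * (real (d v) - real t + 2/3) \<le> 1" if v: "v \<in> {v1, v2}" for v
  proof -
    have f2v: "f2 v = (F v - q) / (1 - \<beta>)" using v piv(3) by (auto simp: f2_def)
    have "(F v - q) * (real (d v) - real t + 2/3) \<le> 1 - \<beta>"
      using v ineq1 ineq2 by (auto simp: \<beta>_def D1_def D2_def le_diff_eq add.commute)
    moreover have "0 \<le> F v - q" using v qF by auto
    ultimately show ?thesis unfolding f2v using \<beta> by (simp add: divide_le_eq)
  qed
  have "admissible V2 E f2"
    unfolding admissible_def
  proof (intro conjI ballI allI impI)
    show "finite V2" by fact
    show "E a b \<Longrightarrow> E b a" "\<not> E a a" for a b using sym irr by auto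
    fix b assume b: "b \<in> V2"
    show "0 \<le> f2 b" using f2v[of v1] f2v[of v2] F_pos[of b] by (auto simp: f2_def)
    show "f2 b * (real (degree V2 E b) + 1/2) \<le> 1"
    proof (cases "b \<in> {v1, v2}")
      case True
      have "{u \<in> V2. E b u} = N b - T" by (auto simp: V2_def)
      then have "real (degree V2 E b) = real (d b) - real t" using cardNT[OF True] by (simp add: degree_def)
      then have "f2 b * (real (degree V2 E b) + 1/2) \<le> f2 b * (real (d b) - real t + 2/3)"
        using f2v[OF True] by (intro mult_left_mono) auto
      then show ?thesis using f2v[OF True] by linarith
    next
      case False
      have "degree V2 E b \<le> d b" by (rule degree_subset[OF fin V12(2)])
      then show ?thesis using False by (simp add: f2_def F_def)
    qed
  next
    fix K assume K: "clique V2 E K"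
    have clG: "clique V E K" by (rule clique_subset[OF K V12(2)])
    have finK: "finite K" using K fin1(2) by (auto simp: clique_def intro: finite_subset[of K V2])
    show "sum f2 K \<le> 1"
    proof (cases "K \<inter> {v1, v2} = {}")
      case True
      then have "sum f2 K = sum F K" by (intro sum.cong) (auto simp: f2_def)
      also have "\<dots> \<le> 1" using sum_F_clique[OF clG] by (rule order_trans) simp
      finally show ?thesis .
    next
      case False
      then obtain v where v: "v \<in> K" "v \<in> {v1, v2}" by auto
      have other: "u \<notin> {v1, v2}" if "u \<in> K - {v}" for u
        using that v K nadj unfolding clique_def by blast
      define m where "m = real (card (K - {v}))"
      define n where "n = real (d v) - real t"
      have "u \<in> V - T" "E v u" if "u \<in> K - {v}" for u
        using that K v(1) by (simp_all add: clique_def subset_iff V2_def not_sym)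
      then have "K - {v} \<subseteq> N v - T" by (simp add: subset_iff)
      then have "card (K - {v}) \<le> card (N v - T)" by (intro card_mono) auto
      then have mn: "m \<le> n" using cardNT[OF v(2)] by (simp add: m_def n_def)
      have m0: "0 \<le> m" by (simp add: m_def)
      have nn: "1 \<le> n" using v(2) n1 by (auto simp: n_def D1_def D2_def)
      have "card K = card (K - {v}) + 1" using card_Suc_Diff1[OF finK v(1)] by simp
      then have "sum F (K - {v}) \<le> m * (1 / (m + 3/2))"
        unfolding m_def using F_le[OF clique_card_le_degree[OF clG]]
        by (intro sum_bounded_above) (auto simp: add.commute)
      moreover have "sum f2 (K - {v}) = sum F (K - {v})"
        using other by (intro sum.cong) (auto simp: f2_def)
      \<comment> \<open>The other \<open>m\<close> vertices of \<open>K\<close> have demand at most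
        \<open>1 / (m + 3/2)\<close> each, which leaves this much for \<open>v\<close>. At
        \<open>m = n\<close> the constant \<open>2/3\<close> suffices precisely because
        \<open>n \<ge> 1\<close>.\<close>
      moreover have "f2 v \<le> (3/2) / (m + 3/2)"
      proof -
        have "f2 v \<le> 1 / (n + 2/3)" using f2v[OF v(2)] nn by (simp add: n_def le_divide_eq)
        also have "\<dots> \<le> (3/2) / (n + 3/2)" using nn by (simp add: field_simps)
        also have "\<dots> \<le> (3/2) / (m + 3/2)" using mn m0 by (intro divide_left_mono) auto
        finally show ?thesis .
      qed
      ultimately have "sum f2 K \<le> (3/2) / (m + 3/2) + m * (1 / (m + 3/2))"
        using sum.remove[OF finK v(1), of f2] by simp
      also have "\<dots> = (m + 3/2) / (m + 3/2)" by (simp only: add_divide_distrib) simp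
      also have "\<dots> = 1" using m0 by simp
      finally show ?thesis .
    qed
  qed
  then have "colorable V2 E f2" by (rule smaller[OF card2])
  then obtain P2 where P2: "stable_dist V2 E P2" "\<And>v. v \<in> V2 \<Longrightarrow> cover V2 P2 {v} = f2 v"
    unfolding colorable_def by auto

  define \<alpha> where "\<alpha> j = (if j then \<beta> else 1 - \<beta>)" for j
  define P where "P j = (if j then P1 else P2)" for j
  define p0 where "p0 = (\<lambda>I. \<Sum>j\<in>UNIV. \<alpha> j * P j I)"
  have st0: "stable_dist V2 E p0"
    unfolding p0_def using \<beta> P1(1) P2(1)
    by (intro stable_dist_average) (auto simp: \<alpha>_def P_def UNIV_bool)
  have cov0: "cover V2 p0 W = \<beta> * cover V2 P1 W + (1 - \<beta>) * cover V2 P2 W" for W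
    unfolding p0_def cover_average by (simp add: UNIV_bool \<alpha>_def P_def)
  have covF: "cover V2 p0 {u} = F u" if u: "u \<in> V2" for u
  proof (cases "u \<in> {v1, v2}")
    case True
    then have "cover V2 P1 {u} = c" using P1(2)[of "{v1}"] P1(3) p1(2) v12 by (auto simp: f1_def)
    moreover have "f2 u = (F u - q) / (1 - \<beta>)" using True piv(3) by (auto simp: f2_def)
    ultimately show ?thesis using cov0[of "{u}"] P2(2)[OF u] \<beta> \<beta>c by simp
  next
    case False
    then have "u \<in> V1" using u by (simp add: V1_def)
    then have "cover V2 P1 {u} = F u" "cover V2 P2 {u} = F u"
      using P1(2)[of "{u}"] p1(2) P2(2)[OF u] False by (auto simp: f1_def f2_def)
    then show ?thesis using cov0[of "{u}"] by (simp add: algebra_simps)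
  qed
  have covq: "q \<le> cover V2 p0 {v1, v2}"
  proof -
    have "cover V2 P1 {v1, v2} = c" using P1(4) p1(2)[OF v12(1)] by (simp add: f1_def)
    moreover have "0 \<le> (1 - \<beta>) * cover V2 P2 {v1, v2}" using cover_nonneg[OF P2(1)] \<beta> by simp
    ultimately show ?thesis using cov0[of "{v1, v2}"] \<beta>c by simp
  qed

  \<comment> \<open>The twins return one at a time; the overlap belongs to the invariant because
    each of them relies on it.\<close>
  have "\<exists>p. stable_dist (V2 \<union> S) E p \<and> (\<forall>u\<in>V2 \<union> S. cover (V2 \<union> S) p {u} = F u) \<and>
      q \<le> cover (V2 \<union> S) p {v1, v2}" if "finite S" "S \<subseteq> T" for S
    using that
  proof (induction S rule: finite_induct)
    case empty
    then show ?case using st0 covF covq by (intro exI[of _ p0]) simp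
  next
    case (insert y S)
    let ?U = "V2 \<union> S"
    obtain p where p: "stable_dist ?U E p" "\<And>u. u \<in> ?U \<Longrightarrow> cover ?U p {u} = F u"
      "q \<le> cover ?U p {v1, v2}" using insert by auto
    have yT: "y \<in> T" and ST: "S \<subseteq> T" using insert by auto
    have yU: "y \<notin> ?U" using yT insert.hyps by (auto simp: V2_def)
    have finU: "finite ?U" using fin1 insert.hyps by simp
    define R where "R = (B - T) \<union> S"
    have finR: "finite R" using finB insert.hyps by (simp add: R_def)
    have RB: "R \<subseteq> B - {y}" using ST TB yT insert.hyps by (auto simp: R_def)
    have RU: "R \<subseteq> ?U" using BV by (auto simp: R_def V2_def)
    have Ny: "u = v1 \<or> u = v2 \<or> u \<in> R" if u: "u \<in> ?U" "E y u" for u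
    proof -
      have "u \<in> V" using u(1) ST TV V12 by auto
      then have "u \<in> C y" using u(2) by simp
      moreover have "C y = C x" using yT by (simp add: T_def)
      ultimately have "u \<in> C x" by metis
      then show ?thesis using u(1) by (auto simp: R_def B_def V2_def)
    qed
    have pnn: "0 \<le> p I" for I using p(1) unfolding stable_dist_def by auto
    \<comment> \<open>Union bound over \<open>R\<close>, but inclusion-exclusion for the pair
      \<open>v1\<close>, \<open>v2\<close>: here the overlap is gained.\<close>
    have "(\<Sum>I\<in>Pow ?U. p I * of_bool (\<exists>u\<in>I. E y u)) \<le>
        (\<Sum>I\<in>Pow ?U. p I * ((\<Sum>u\<in>R. of_bool ({u} \<subseteq> I)) + of_bool ({v1} \<subseteq> I) + of_bool ({v2} \<subseteq> I)
            - of_bool ({v1, v2} \<subseteq> I)))"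
    proof (intro sum_mono mult_left_mono pnn)
      fix I assume I: "I \<in> Pow ?U"
      have nn: "0 \<le> (\<Sum>u\<in>R. of_bool ({u} \<subseteq> I) :: real)" by (intro sum_nonneg) simp
      show "of_bool (\<exists>u\<in>I. E y u) \<le> (\<Sum>u\<in>R. of_bool ({u} \<subseteq> I)) + of_bool ({v1} \<subseteq> I)
          + of_bool ({v2} \<subseteq> I) - (of_bool ({v1, v2} \<subseteq> I) :: real)"
      proof (cases "\<exists>u\<in>R. u \<in> I")
        case True
        then obtain u where u: "u \<in> R" "u \<in> I" by auto
        have "of_bool ({u} \<subseteq> I) \<le> (\<Sum>u\<in>R. of_bool ({u} \<subseteq> I) :: real)"
          using finR u by (intro member_le_sum) auto
        then have "1 \<le> (\<Sum>u\<in>R. of_bool ({u} \<subseteq> I) :: real)" using u by simp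
        then show ?thesis by auto
      next
        case False
        then have "(\<exists>u\<in>I. E y u) \<Longrightarrow> v1 \<in> I \<or> v2 \<in> I" using Ny I by blast
        then show ?thesis using nn by auto
      qed
    qed
    also have "\<dots> = (\<Sum>u\<in>R. cover ?U p {u}) + cover ?U p {v1} + cover ?U p {v2} - cover ?U p {v1, v2}"
    proof -
      have "(\<Sum>u\<in>R. cover ?U p {u}) = (\<Sum>I\<in>Pow ?U. p I * (\<Sum>u\<in>R. of_bool ({u} \<subseteq> I)))"
        unfolding cover_def by (subst sum.swap) (simp add: sum_distrib_left)
      then show ?thesis
        unfolding cover_def by (simp only: sum.distrib sum_subtractf distrib_left right_diff_distrib)
    qed
    also have "(\<Sum>u\<in>R. cover ?U p {u}) = sum F R" using RU p(2) by (intro sum.cong) auto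
    also have "cover ?U p {v1} = F v1" using p(2) v12 by simp
    also have "cover ?U p {v2} = F v2" using p(2) v12 by simp
    finally have bound: "(\<Sum>I\<in>Pow ?U. p I * of_bool (\<exists>u\<in>I. E y u)) \<le> sum F R + F v1 + F v2 - q"
      using p(3) by simp
    have "sum F R \<le> sum F (B - {y})" using finB RB F_pos by (intro sum_mono2) (auto intro: less_imp_le)
    moreover have "sum F B = F y + sum F (B - {y})" using sum.remove[OF finB, of y F] yT TB by auto
    ultimately have room: "F y + (\<Sum>I\<in>Pow ?U. p I * of_bool (\<exists>u\<in>I. E y u)) \<le> 1"
      using bound sumC by (simp add: q_def)
    obtain p' where p': "stable_dist (insert y ?U) E p'" "cover (insert y ?U) p' {y} = F y"
      "\<And>W. W \<subseteq> ?U \<Longrightarrow> cover (insert y ?U) p' W = cover ?U p W"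
      using stable_dist_extend[OF finU yU sym irr p(1) less_imp_le[OF F_pos] room] by blast
    have "cover (insert y ?U) p' {u} = F u" if "u \<in> insert y ?U" for u
      using that p'(2) p'(3)[of "{u}"] p(2) by auto
    moreover have "q \<le> cover (insert y ?U) p' {v1, v2}" using p'(3)[of "{v1, v2}"] v12 p(3) by simp
    ultimately show ?case using p'(1) by (intro exI[of _ p']) simp
  qed
  from this[OF finT subset_refl] have "\<exists>p. stable_dist V E p \<and> (\<forall>u\<in>V. cover V p {u} = F u)"
    using TV by (auto simp: V2_def Un_absorb2)
  then show ?thesis unfolding colorable_def .
qed

end

section \<open>The induction\<close>

text \<open>If no vertex can be added greedily, then \<open>f\<close> lies below \<open>F\<close>,
  which one of the two constructions colors, and the coloring is trimmed back to
  \<open>f\<close>.\<close>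

lemma admissible_imp_colorable: "admissible (V :: 'a set) E f \<Longrightarrow> colorable V E f"
proof (induction "card V" arbitrary: V E f rule: less_induct)
  case less
  let ?C = "\<lambda>x. insert x {u \<in> V. E x u}"
  have fin: "finite V" and sym: "\<And>u v. E u v \<Longrightarrow> E v u" and irr: "\<And>v. \<not> E v v"
    and f0: "\<And>v. v \<in> V \<Longrightarrow> 0 \<le> f v" and deg: "\<And>v. v \<in> V \<Longrightarrow> f v * (real (degree V E v) + 1/2) \<le> 1"
    and clq: "\<And>K. clique V E K \<Longrightarrow> sum f K \<le> 1"
    using less.prems unfolding admissible_def by blast+
  consider "V = {}" | x where "x \<in> V" "sum f (?C x) \<le> 1" | "V \<noteq> {}" "\<And>x. x \<in> V \<Longrightarrow> 1 < sum f (?C x)"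
    by (meson not_le)
  then show ?case
  proof cases
    case 1
    then have "stable_dist V E (\<lambda>_. 1)" by (simp add: stable_dist_def)
    then show ?thesis using 1 unfolding colorable_def by blast
  next
    case 2
    let ?U = "V - {x}"
    have Vi: "V = insert x ?U" and U: "finite ?U" "x \<notin> ?U" using 2 fin by auto
    have "colorable ?U E f"
      using less.hyps[OF card_Diff1_less[OF fin 2(1)] admissible_subset[OF less.prems]] by blast
    then obtain p where p: "stable_dist ?U E p" "\<And>v. v \<in> ?U \<Longrightarrow> cover ?U p {v} = f v"
      unfolding colorable_def by blast
    have N: "{u \<in> ?U. E x u} = {u \<in> V. E x u}" using irr by auto
    have "(\<Sum>u\<in>{u \<in> ?U. E x u}. cover ?U p {u}) = (\<Sum>u\<in>{u \<in> ?U. E x u}. f u)"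
      using p(2) by (intro sum.cong) auto
    moreover have "sum f (?C x) = f x + sum f {u \<in> V. E x u}" using fin irr by simp
    ultimately have "f x + (\<Sum>I\<in>Pow ?U. p I * of_bool (\<exists>u\<in>I. E x u)) \<le> 1"
      using union_bound[OF U(1) p(1), of x] 2(2) unfolding N by linarith
    then obtain p' where p': "stable_dist (insert x ?U) E p'" "cover (insert x ?U) p' {x} = f x"
      "\<And>W. W \<subseteq> ?U \<Longrightarrow> cover (insert x ?U) p' W = cover ?U p W"
      using stable_dist_extend[OF U sym irr p(1) f0[OF 2(1)]] by blast
    have "cover V p' {v} = f v" if "v \<in> V" for v
      using p'(2) p'(3)[of "{v}"] p(2)[of v] that unfolding Vi[symmetric] by (cases "v = x") auto
    then show ?thesis using p'(1) unfolding colorable_def Vi[symmetric] by blast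
  next
    case 3
    have le: "f v \<le> 1 / (real (degree V E v) + 1/2)" if "v \<in> V" for v
      using deg[OF that] by (simp add: le_divide_eq)
    interpret minimal_graph V E
    proof
      show "finite V" by fact
      show "E u v \<Longrightarrow> E v u" "\<not> E v v" for u v using sym irr by blast+
      show "\<not> clique V E (?C x)" if "x \<in> V" for x using clq[of "?C x"] 3(2)[OF that] by auto
      show "1 < (\<Sum>u\<in>?C x. 1 / (real (degree V E u) + 1/2))" if "x \<in> V" for x
      proof -
        have "sum f (?C x) \<le> (\<Sum>u\<in>?C x. 1 / (real (degree V E u) + 1/2))"
          using le that by (intro sum_mono) auto
        then show ?thesis using 3(2)[OF that] by linarith
      qed
      show "card V' < card V \<Longrightarrow> admissible V' E' f' \<Longrightarrow> colorable V' E' f'" for V' :: "'a set" and E' f'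
        by (rule less.hyps)
    qed
    have "colorable V E F"
    \<comment> \<open>Over the integers the failure of this inequality is the \<open>+ 1\<close>
      form required for averaging, so the two constructions cover all cases.\<close>
    proof (cases "\<exists>u\<in>V. two_pivots u \<and> 2 * d u \<le> 3 * card {y \<in> V. C y = C u}")
      case True
      then show ?thesis using colorable_by_identification unfolding two_pivots_def by blast
    next
      case False
      then show ?thesis using 3(1) by (intro colorable_by_averaging) force+
    qed
    then obtain p where "stable_dist V E p" "\<And>v. v \<in> V \<Longrightarrow> cover V p {v} = F v"
      unfolding colorable_def by blast
    then show ?thesis using f0 le by (intro colorable_trim[OF fin]) (auto simp: F_def)
  qed
qed

theorem theorem1p3:
  fixes V :: "'a set" and E :: "'a \<Rightarrow> 'a \<Rightarrow> bool" and f :: "'a \<Rightarrow> real" and \<epsilon> :: real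
  assumes "\<epsilon> \<le> 1/2"
    and "simple_graph V E"
    and "demand_function V f"
    and "\<forall>v\<in>V. f v \<le> 1 / (real (degree V E v) + 1 - \<epsilon>)"
    and "\<forall>K. clique V E K \<longrightarrow> (\<Sum>v\<in>K. f v) \<le> 1"
  shows "\<exists>\<phi>. f_coloring V E f \<phi>"
proof -
  have "f v * (real (degree V E v) + 1/2) \<le> 1" if "v \<in> V" for v
  proof -
    have "f v \<le> 1 / (real (degree V E v) + 1 - \<epsilon>)" using assms(4) that by blast
    also have "\<dots> \<le> 1 / (real (degree V E v) + 1/2)" using assms(1) by (intro divide_left_mono) auto
    finally show ?thesis by (simp add: le_divide_eq)
  qed
  then have "admissible V E f"
    using assms(2,3,5) unfolding admissible_def simple_graph_def demand_function_def by blast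
  then show ?thesis
    using f_coloring_of_colorable admissible_imp_colorable unfolding admissible_def by blast
qed

end
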